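(* Let $Y$ be a compact Hausdorff space without isolated points, $A\subset Y$ finite and nonempty, and $X_1=\mathrm{FMQ}(Y,A,\mathcal{D}_Y)$ with projection $q_1\colon Y\to X_1$ and collapsed point $\ast_1=q_1(A)$. Let $B=\{\hat b_1,\dots,\hat b_m\}\subset X_1\setminus\{\ast_1\}$ be finite and nonempty, where $\hat b_i=q_1(b_i)$ with $b_i\in Y\setminus A$. Then $X_2:=\mathrm{FMQ}(X_1,B,\mathcal{D}_{X_1})$ is canonically homeomorphic (via the bijection compatible with the projections from $Y$) to the multi-point FMQ of $Y$ collapsing $A$ to $\ast_1$ and $\{b_1,\dots,b_m\}$ to $\ast_2$, with the density modifier $\mathcal{D}_Y$ applied at both collapsed points.
   Context: For a topological space $Z$, $\mathcal{D}_Z$ denotes the collection of dense subsets of $Z$. For nonempty $A\subseteq Z$, let $q\colon Z\to Z/A$ be the projection (of sets) collapsing $A$ to one point $\ast=q(A)$; $\mathrm{FMQ}(Z,A,\mathcal{D}_Z)$ is the set $Z/A$ with the topology of all $U\subseteq Z/A$ such that $q^{-1}(U)$ is open in $Z$ and ($\ast\in U\Rightarrow q^{-1}(U)\in\mathcal{D}_Z$). Multi-point FMQ: for pairwise disjoint nonempty $A_1,\dots,A_r\subseteq Y$, collapse each $A_i$ to a distinct point $\ast_i$, with projection $q$; with density modifier $\mathcal{D}_Y$, a set $U$ is declared open iff $q^{-1}(U)$ is open in $Y$ and, for each $i$, $\ast_i\in U\Rightarrow q^{-1}(U)\in\mathcal{D}_Y$. *)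

theory Defs
  imports "HOL-Analysis.Analysis" "HOL-Library.Disjoint_Sets"
begin

definition dense_subsets :: "'a topology \<Rightarrow> 'a set set" where
  "dense_subsets Z = {S. S \<subseteq> topspace Z \<and> Z closure_of S = topspace Z}"

definition no_isolated_points :: "'a topology \<Rightarrow> bool" where
  "no_isolated_points Z \<longleftrightarrow> (\<forall>z\<in>topspace Z. \<not> openin Z {z})"

text \<open>
  The points of a set-theoretic quotient are equivalence classes. When the members of the
  family are pairwise disjoint nonempty subsets of the space, the class of any point of a
  member \<open>A\<close> is \<open>A\<close> itself, so \<open>A\<close>, regarded as an element of the quotient, is the point
  to which \<open>A\<close> is collapsed; see \<open>collapse_image\<close> below. All other classes are singletons.
\<close>

definition collapse_rel :: "'a topology \<Rightarrow> 'a set set \<Rightarrow> ('a \<times> 'a) set" where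
  "collapse_rel Z \<A> =
     {(x, y). x \<in> topspace Z \<and> y \<in> topspace Z \<and> (x = y \<or> (\<exists>A\<in>\<A>. x \<in> A \<and> y \<in> A))}"

definition collapse :: "'a topology \<Rightarrow> 'a set set \<Rightarrow> 'a \<Rightarrow> 'a set" where
  "collapse Z \<A> z = collapse_rel Z \<A> `` {z}"

definition collapse_vimage :: "'a topology \<Rightarrow> 'a set set \<Rightarrow> 'a set set \<Rightarrow> 'a set" where
  "collapse_vimage Z \<A> U = {z \<in> topspace Z. collapse Z \<A> z \<in> U}"

text \<open>
  For an arbitrary density modifier \<open>\<D>\<close> the sets below need not form a topology; for
  \<open>\<D> = dense_subsets Z\<close> they do, see \<open>openin_multi_FMQ_dense\<close> and \<open>openin_FMQ_dense\<close>.
\<close>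

definition multi_FMQ :: "'a topology \<Rightarrow> 'a set set \<Rightarrow> 'a set set \<Rightarrow> 'a set topology" where
  "multi_FMQ Z \<A> \<D> = topology (\<lambda>U.
     U \<subseteq> topspace Z // collapse_rel Z \<A> \<and>
     openin Z (collapse_vimage Z \<A> U) \<and>
     (\<forall>A\<in>\<A>. A \<in> U \<longrightarrow> collapse_vimage Z \<A> U \<in> \<D>))"

definition FMQ :: "'a topology \<Rightarrow> 'a set \<Rightarrow> 'a set set \<Rightarrow> 'a set topology" where
  "FMQ Z A \<D> = topology (\<lambda>U.
     U \<subseteq> topspace Z // collapse_rel Z {A} \<and>
     openin Z (collapse_vimage Z {A} U) \<and>
     (A \<in> U \<longrightarrow> collapse_vimage Z {A} U \<in> \<D>))"

lemma equiv_collapse_rel: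
  assumes "disjoint \<A>"
  shows "equiv (topspace Z) (collapse_rel Z \<A>)"
proof (rule equivI)
  show "trans (collapse_rel Z \<A>)"
  proof (rule transI)
    fix x y z assume xy: "(x, y) \<in> collapse_rel Z \<A>" and yz: "(y, z) \<in> collapse_rel Z \<A>"
    show "(x, z) \<in> collapse_rel Z \<A>"
    proof (cases "x = y \<or> y = z")
      case False
      then obtain A A' where "A \<in> \<A>" "x \<in> A" "y \<in> A" "A' \<in> \<A>" "y \<in> A'" "z \<in> A'"
        using xy yz unfolding collapse_rel_def by auto
      moreover from this have "A = A'"
        using disjointD[OF assms, of A A'] by auto
      ultimately show ?thesis
        using xy yz unfolding collapse_rel_def by auto
    qed (use xy yz in auto)
  qed
qed (auto simp: collapse_rel_def refl_on_def sym_def)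

lemma collapse_member:
  assumes "disjoint \<A>" "A \<in> \<A>" "A \<subseteq> topspace Z" "z \<in> A"
  shows "collapse Z \<A> z = A"
proof -
  have *: "A' = A" if "A' \<in> \<A>" "z \<in> A'" for A'
    using disjointD[OF assms(1) that(1) assms(2)] that(2) assms(4) by auto
  have "(z, y) \<in> collapse_rel Z \<A> \<longleftrightarrow> y \<in> A" for y
    using * assms(2-4) unfolding collapse_rel_def by blast
  then show ?thesis
    unfolding collapse_def by auto
qed

lemma collapse_image:
  assumes "disjoint \<A>" "A \<in> \<A>" "A \<subseteq> topspace Z" "A \<noteq> {}"
  shows "collapse Z \<A> ` A = {A}"
  using collapse_member[OF assms(1-3)] assms(4) by auto

lemma collapse_nonmember:
  assumes "z \<in> topspace Z" "z \<notin> \<Union>\<A>"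
  shows "collapse Z \<A> z = {z}"
  using assms unfolding collapse_def collapse_rel_def by auto

lemma dense_subsets_mono:
  assumes "S \<in> dense_subsets Z" "S \<subseteq> T" "T \<subseteq> topspace Z"
  shows "T \<in> dense_subsets Z"
  using assms closure_of_mono[OF assms(2), of Z] closure_of_subset_topspace[of Z T]
  unfolding dense_subsets_def by auto

lemma dense_subsets_Int_open:
  assumes "S \<in> dense_subsets Z" "T \<in> dense_subsets Z" "openin Z S"
  shows "S \<inter> T \<in> dense_subsets Z"
  using assms closure_of_openin_Int_closure_of[OF assms(3), of T]
  unfolding dense_subsets_def by (auto simp: Int_absorb2)

lemma istopology_multi_FMQ_dense:
  "istopology (\<lambda>U.
     U \<subseteq> topspace Z // collapse_rel Z \<A> \<and>
     openin Z (collapse_vimage Z \<A> U) \<and>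
     (\<forall>A\<in>\<A>. A \<in> U \<longrightarrow> collapse_vimage Z \<A> U \<in> dense_subsets Z))"
  (is "istopology ?P")
proof -
  let ?p = "collapse_vimage Z \<A>"
  have Int: "?p (U \<inter> V) = ?p U \<inter> ?p V" for U V
    by (auto simp: collapse_vimage_def)
  have Un: "?p (\<Union>\<K>) = \<Union>(?p ` \<K>)" for \<K>
    by (auto simp: collapse_vimage_def)
  have P_Int: "?P (U \<inter> V)" if "?P U" "?P V" for U V
  proof (intro conjI ballI impI)
    show "U \<inter> V \<subseteq> topspace Z // collapse_rel Z \<A>"
      using that by blast
    show "openin Z (?p (U \<inter> V))"
      using that by (simp add: Int openin_Int)
    fix A assume "A \<in> \<A>" "A \<in> U \<inter> V"
    then show "?p (U \<inter> V) \<in> dense_subsets Z"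
      using that unfolding Int by (intro dense_subsets_Int_open) blast+
  qed
  have P_Union: "?P (\<Union>\<K>)" if \<K>: "\<forall>U\<in>\<K>. ?P U" for \<K>
  proof (intro conjI ballI impI)
    show "openin Z (?p (\<Union>\<K>))"
      unfolding Un using \<K> by (intro openin_Union) blast
    fix A assume "A \<in> \<A>" "A \<in> \<Union>\<K>"
    then obtain U where U: "U \<in> \<K>" "?p U \<in> dense_subsets Z"
      using \<K> by blast
    have "?p U \<subseteq> ?p (\<Union>\<K>)" "?p (\<Union>\<K>) \<subseteq> topspace Z"
      using U(1) unfolding collapse_vimage_def by auto
    then show "?p (\<Union>\<K>) \<in> dense_subsets Z"
      by (rule dense_subsets_mono[OF U(2)])
  next
    show "\<Union>\<K> \<subseteq> topspace Z // collapse_rel Z \<A>"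
      using \<K> by (intro Union_least) blast
  qed
  show ?thesis
    unfolding istopology_def
  proof (rule conjI; intro allI impI)
    show "?P (U \<inter> V)" if "?P U" "?P V" for U V
      using that by (rule P_Int)
    show "?P (\<Union>\<K>)" if "\<forall>U\<in>\<K>. ?P U" for \<K>
      using that by (rule P_Union)
  qed
qed

lemma openin_multi_FMQ_dense:
  "openin (multi_FMQ Z \<A> (dense_subsets Z)) U \<longleftrightarrow>
     U \<subseteq> topspace Z // collapse_rel Z \<A> \<and>
     openin Z (collapse_vimage Z \<A> U) \<and>
     (\<forall>A\<in>\<A>. A \<in> U \<longrightarrow> collapse_vimage Z \<A> U \<in> dense_subsets Z)"
  unfolding multi_FMQ_def by (subst topology_inverse'[OF istopology_multi_FMQ_dense]) (rule refl)

lemma FMQ_eq_multi_FMQ: "FMQ Z A \<D> = multi_FMQ Z {A} \<D>"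
  unfolding FMQ_def multi_FMQ_def by simp

lemma openin_FMQ_dense:
  "openin (FMQ Z A (dense_subsets Z)) U \<longleftrightarrow>
     U \<subseteq> topspace Z // collapse_rel Z {A} \<and>
     openin Z (collapse_vimage Z {A} U) \<and>
     (A \<in> U \<longrightarrow> collapse_vimage Z {A} U \<in> dense_subsets Z)"
  by (simp add: FMQ_eq_multi_FMQ openin_multi_FMQ_dense)

lemma topspace_multi_FMQ_dense:
  "topspace (multi_FMQ Z \<A> (dense_subsets Z)) = topspace Z // collapse_rel Z \<A>"
proof -
  have "collapse_vimage Z \<A> (topspace Z // collapse_rel Z \<A>) = topspace Z"
    by (auto simp: collapse_vimage_def collapse_def intro: quotientI)
  then have "openin (multi_FMQ Z \<A> (dense_subsets Z)) (topspace Z // collapse_rel Z \<A>)"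
    unfolding openin_multi_FMQ_dense by (simp add: dense_subsets_def)
  then show ?thesis
    using openin_subset openin_multi_FMQ_dense[of Z \<A>, THEN iffD1, OF openin_topspace]
    by (intro subset_antisym) simp_all
qed

lemma topspace_FMQ_dense:
  "topspace (FMQ Z A (dense_subsets Z)) = topspace Z // collapse_rel Z {A}"
  by (simp add: FMQ_eq_multi_FMQ topspace_multi_FMQ_dense)

end

theory Submission
  imports Defs
begin

text \<open>
  A point of the iterated quotient is a set of classes, and the homeomorphism takes its union.
  Open sets correspond because density in \<open>X1\<close> and density of the preimage in \<open>Y\<close> agree: as
  \<open>Y\<close> is a T1 space without isolated points, removing the finite set \<open>A\<close> from a nonempty open
  set \<open>T\<close> leaves a nonempty open set, and this set is saturated and misses the collapsed point,
  so its image is open in \<open>X1\<close> and meets every dense subset of \<open>X1\<close>.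
\<close>

lemma quotient_collapse_rel: "topspace Z // collapse_rel Z \<A> = collapse Z \<A> ` topspace Z"
  by (auto simp: quotient_def collapse_def)

lemma collapse_singleton_family:
  assumes "A \<subseteq> topspace Z" "z \<in> topspace Z"
  shows "collapse Z {A} z = (if z \<in> A then A else {z})"
  using assms by (auto simp: collapse_def collapse_rel_def)

lemma collapse_pair_family:
  assumes "A \<subseteq> topspace Z" "C \<subseteq> topspace Z" "A \<inter> C = {}" "z \<in> topspace Z"
  shows "collapse Z {A, C} z = (if z \<in> A then A else if z \<in> C then C else {z})"
  using assms by (auto simp: collapse_def collapse_rel_def)

lemma dense_subsets_iff_meets_open:
  "S \<in> dense_subsets Z \<longleftrightarrow>
     S \<subseteq> topspace Z \<and> (\<forall>T. openin Z T \<and> T \<noteq> {} \<longrightarrow> S \<inter> T \<noteq> {})"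
  by (auto simp: dense_subsets_def dense_intersects_open)

text \<open>This turns the density condition of the second collapse, stated in the first quotient,
  into one about \<open>Y\<close>. From right to left it suffices that a nonempty open set of the
  quotient has a nonempty open preimage.\<close>

lemma dense_subsets_FMQ_iff:
  assumes "t1_space Y" "no_isolated_points Y" "finite A" "A \<subseteq> topspace Y"
    and V: "V \<subseteq> topspace (FMQ Y A (dense_subsets Y))"
  shows "V \<in> dense_subsets (FMQ Y A (dense_subsets Y)) \<longleftrightarrow>
         collapse_vimage Y {A} V \<in> dense_subsets Y"
    (is "V \<in> dense_subsets ?X \<longleftrightarrow> ?W \<in> _")
proof
  assume V_dense: "V \<in> dense_subsets ?X"
  show "?W \<in> dense_subsets Y"
    unfolding dense_subsets_iff_meets_open
  proof (intro conjI allI impI)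
    show "?W \<subseteq> topspace Y"
      by (auto simp: collapse_vimage_def)
    fix T assume T: "openin Y T \<and> T \<noteq> {}"
    have "closedin Y A"
      using assms by (simp add: t1_space_closedin_finite)
    then have T_A: "openin Y (T - A)"
      using T by (simp add: openin_diff)
    \<comment> \<open>Otherwise \<open>T\<close> is finite, and by T1 removing all its points but
      one, \<open>t\<close>, leaves the open set \<open>{t}\<close>, an isolated point.\<close>
    have "T - A \<noteq> {}"
    proof
      assume "T - A = {}"
      then have "finite T"
        using \<open>finite A\<close> finite_subset by auto
      obtain t where t: "t \<in> T"
        using T by auto
      have "T - {t} \<subseteq> topspace Y"
        using openin_subset T by blast
      then have "closedin Y (T - {t})"
        using \<open>finite T\<close> \<open>t1_space Y\<close> by (simp add: t1_space_closedin_finite)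
      then have "openin Y (T - (T - {t}))"
        using T by (blast intro: openin_diff)
      moreover have "T - (T - {t}) = {t}"
        using t by auto
      ultimately show False
        using t T openin_subset \<open>no_isolated_points Y\<close> unfolding no_isolated_points_def by fastforce
    qed
    have T_sub: "T \<subseteq> topspace Y"
      using T openin_subset by blast
    \<comment> \<open>Points outside \<open>A\<close> have singleton classes, so the preimage of
      \<open>?Q\<close> is exactly \<open>T - A\<close>; as \<open>A\<close> is not in
      \<open>?Q\<close>, its openness carries no density condition.\<close>
    let ?Q = "collapse Y {A} ` (T - A)"
    have A_notin: "A \<notin> ?Q"
      using T_sub \<open>A \<subseteq> topspace Y\<close> by (auto simp: collapse_singleton_family)
    have vimage_Q: "collapse_vimage Y {A} ?Q = T - A"
      using T_sub \<open>A \<subseteq> topspace Y\<close>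
      by (auto simp: collapse_vimage_def collapse_singleton_family subset_iff image_iff
          split: if_splits)
    have "openin ?X ?Q"
      unfolding openin_FMQ_dense vimage_Q quotient_collapse_rel
      using T_A T_sub A_notin by auto
    then have "V \<inter> ?Q \<noteq> {}"
      using V_dense \<open>T - A \<noteq> {}\<close> unfolding dense_subsets_iff_meets_open by blast
    then show "?W \<inter> T \<noteq> {}"
      using T_sub by (auto simp: collapse_vimage_def)
  qed
next
  assume W_dense: "?W \<in> dense_subsets Y"
  show "V \<in> dense_subsets ?X"
    unfolding dense_subsets_iff_meets_open
  proof (intro conjI allI impI)
    fix T assume T: "openin ?X T \<and> T \<noteq> {}"
    then have "collapse_vimage Y {A} T \<noteq> {}"
      by (auto simp: openin_FMQ_dense quotient_collapse_rel collapse_vimage_def)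
    then have "?W \<inter> collapse_vimage Y {A} T \<noteq> {}"
      using W_dense T unfolding dense_subsets_iff_meets_open openin_FMQ_dense by blast
    then show "V \<inter> T \<noteq> {}"
      by (auto simp: collapse_vimage_def)
  qed (rule V)
qed

theorem proposition7p10:
  fixes Y :: "'a topology" and A :: "'a set"
    and X1 M :: "'a set topology" and X2 :: "'a set set topology"
    and B :: "'a set set" and b :: "nat \<Rightarrow> 'a" and m :: nat
    and q1 q :: "'a \<Rightarrow> 'a set" and q2 :: "'a set \<Rightarrow> 'a set set"
  assumes "compact_space Y" and "Hausdorff_space Y" and "no_isolated_points Y"
    and "A \<subseteq> topspace Y" and "finite A" and "A \<noteq> {}"
    and X1: "X1 = FMQ Y A (dense_subsets Y)" and q1: "q1 = collapse Y {A}"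
    and "B \<subseteq> topspace X1 - q1 ` A" and "finite B" and "B \<noteq> {}"
    and "\<And>i. i \<in> {1..m} \<Longrightarrow> b i \<in> topspace Y - A"
    and "B = (\<lambda>i. q1 (b i)) ` {1..m}"
    and X2: "X2 = FMQ X1 B (dense_subsets X1)" and q2: "q2 = collapse X1 {B}"
    and M: "M = multi_FMQ Y {A, b ` {1..m}} (dense_subsets Y)"
    and q: "q = collapse Y {A, b ` {1..m}}"
  shows "\<exists>h. homeomorphic_map X2 M h
           \<and> (\<forall>y\<in>topspace Y. h (q2 (q1 y)) = q y)
           \<and> (\<forall>h'. bij_betw h' (topspace X2) (topspace M)
                  \<and> (\<forall>y\<in>topspace Y. h' (q2 (q1 y)) = q y)
                \<longrightarrow> (\<forall>x\<in>topspace X2. h' x = h x))"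
proof -
  \<comment> \<open>The second set to be collapsed in \<open>Y\<close>. Its points avoid
    \<open>A\<close>, so \<open>B\<close> consists of their singleton classes (\<open>B_eq\<close>)
    and has union \<open>C\<close>.\<close>
  define C where "C = b ` {1..m}"
  have C_sub: "C \<subseteq> topspace Y" and AC: "A \<inter> C = {}"
    using assms(12) by (auto simp: C_def)
  have A_sub: "A \<subseteq> topspace Y"
    by fact
  have q1_eq: "q1 y = (if y \<in> A then A else {y})" if "y \<in> topspace Y" for y
    using that A_sub by (simp add: q1 collapse_singleton_family)
  have q_eq: "q y = (if y \<in> A then A else if y \<in> C then C else {y})" if "y \<in> topspace Y" for y
    unfolding q C_def[symmetric] using A_sub C_sub AC that by (rule collapse_pair_family)
  have top1: "topspace X1 = q1 ` topspace Y"
    by (simp add: X1 q1 topspace_FMQ_dense quotient_collapse_rel)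
  have top2: "topspace X2 = q2 ` q1 ` topspace Y"
    unfolding top1[symmetric] by (simp add: X2 q2 topspace_FMQ_dense quotient_collapse_rel)
  have topM: "topspace M = q ` topspace Y"
    by (simp add: M q topspace_multi_FMQ_dense quotient_collapse_rel)
  have B_sub: "B \<subseteq> topspace X1"
    using assms(9) by blast
  have q2_eq: "q2 z = (if z \<in> B then B else {z})" if "z \<in> topspace X1" for z
    unfolding q2 using B_sub that by (rule collapse_singleton_family)
  have B_eq: "B = (\<lambda>c. {c}) ` C"
    using assms(12) by (auto simp: assms(13) C_def q1_eq image_iff)
  have A_notin: "A \<notin> B"
    using AC \<open>A \<noteq> {}\<close> by (auto simp: B_eq)
  \<comment> \<open>The three kinds of points of \<open>X2\<close> have unions \<open>A\<close>,
    \<open>C\<close> and \<open>{y}\<close>, which are the values of \<open>q\<close>; this is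
    \<open>h_p\<close>.\<close>
  have p_eq: "q2 (q1 y) = (if y \<in> A then {A} else if y \<in> C then B else {{y}})"
    if "y \<in> topspace Y" for y
    using that AC A_notin q2_eq[of "q1 y"] by (auto simp: top1 q1_eq B_eq)
  have h_p: "\<Union>(q2 (q1 y)) = q y" if "y \<in> topspace Y" for y
    using that by (auto simp: p_eq q_eq B_eq)
  have A_in: "A \<in> topspace X1"
    using \<open>A \<noteq> {}\<close> A_sub q1_eq unfolding top1 by (metis all_not_in_conv image_eqI subsetD)
  have B_in: "B \<in> topspace X2"
  proof -
    obtain z where "z \<in> B"
      using \<open>B \<noteq> {}\<close> by blast
    then show ?thesis
      using B_sub q2_eq[of z] unfolding top2 top1[symmetric] by (metis image_eqI subsetD)
  qed
  have dense1: "V \<in> dense_subsets X1 \<longleftrightarrow> collapse_vimage Y {A} V \<in> dense_subsets Y"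
    if "V \<subseteq> topspace X1" for V
    using that assms(2,3,4,5) unfolding X1
    by (intro dense_subsets_FMQ_iff) (auto intro: Hausdorff_imp_t1_space)
  have inj: "inj_on Union (topspace X2)"
  proof (rule inj_onI)
    fix x x' assume "x \<in> topspace X2" "x' \<in> topspace X2" and eq: "\<Union>x = \<Union>x'"
    then obtain y y' where y: "y \<in> topspace Y" "x = q2 (q1 y)" "y' \<in> topspace Y" "x' = q2 (q1 y')"
      unfolding top2 by auto
    then have "q y = q y'"
      using eq by (simp add: h_p)
    \<comment> \<open>Since \<open>A\<close> and \<open>C\<close> are disjoint, equal values of
      \<open>q\<close> put \<open>y\<close> and \<open>y'\<close> in the same case of
      \<open>p_eq\<close>.\<close>
    then show "x = x'"
      using y AC by (auto simp: p_eq q_eq split: if_splits)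
  qed
  \<comment> \<open>An injective quotient map is a homeomorphism, so continuity in both directions
    reduces to one equivalence for each \<open>V\<close>.\<close>
  have quot: "quotient_map X2 M Union"
    unfolding quotient_map_def
  proof (intro conjI allI impI)
    show "Union ` topspace X2 = topspace M"
      unfolding top2 topM by (simp add: image_image h_p cong: image_cong)
    fix V assume V: "V \<subseteq> topspace M"
    \<comment> \<open>\<open>V\<close> is pulled back in stages to \<open>X2\<close>,
      \<open>X1\<close> and \<open>Y\<close>; by \<open>h_p\<close> the last set \<open>W\<close> is
      also its preimage under \<open>q\<close>.\<close>
    define U where "U = {x \<in> topspace X2. \<Union>x \<in> V}"
    define V1 where "V1 = collapse_vimage X1 {B} U"
    define W where "W = collapse_vimage Y {A} V1"
    have V1_sub: "V1 \<subseteq> topspace X1"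
      by (auto simp: V1_def collapse_vimage_def)
    have W_eq: "W = collapse_vimage Y {A, C} V"
    proof -
      have "W = {y \<in> topspace Y. q2 (q1 y) \<in> U}"
        by (auto simp: W_def V1_def collapse_vimage_def top1 simp flip: q1 q2)
      also have "\<dots> = {y \<in> topspace Y. q y \<in> V}"
        using h_p by (auto simp: U_def top2)
      finally show ?thesis
        by (simp add: collapse_vimage_def flip: q[folded C_def])
    qed
    have B_iff: "B \<in> U \<longleftrightarrow> C \<in> V"
      using B_in by (simp add: U_def B_eq)
    \<comment> \<open>Here \<open>A\<close> is the first collapsed point, an element of
      \<open>X1\<close>. Its image \<open>{A}\<close> has union \<open>A\<close>, so the density
      conditions at this point match.\<close>
    have q2_A: "q2 A = {A}"
      using q2_eq[OF A_in] A_notin by simp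
    then have "{A} \<in> topspace X2"
      using A_in unfolding top2 top1[symmetric] by (metis image_eqI)
    then have A_iff: "A \<in> V1 \<longleftrightarrow> A \<in> V"
      using A_in q2_A by (simp add: V1_def U_def collapse_vimage_def flip: q2)
    have "openin X2 U \<longleftrightarrow> openin X1 V1 \<and> (B \<in> U \<longrightarrow> V1 \<in> dense_subsets X1)"
      unfolding X2 openin_FMQ_dense V1_def
      using topspace_FMQ_dense[of X1 B] by (auto simp: U_def X2)
    \<comment> \<open>Openness of \<open>V1\<close> contributes the condition at the first collapsed
      point; \<open>dense1\<close> moves the condition at the second one from \<open>V1\<close> to
      \<open>W\<close>.\<close>
    also have "\<dots> \<longleftrightarrow> openin Y W \<and> (A \<in> V1 \<longrightarrow> W \<in> dense_subsets Y) \<and>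
                     (B \<in> U \<longrightarrow> W \<in> dense_subsets Y)"
      using V1_sub dense1[OF V1_sub] topspace_FMQ_dense[of Y A]
      unfolding X1 openin_FMQ_dense W_def by auto
    also have "\<dots> \<longleftrightarrow> openin M V"
      using V topspace_multi_FMQ_dense[of Y "{A, C}"]
      unfolding M openin_multi_FMQ_dense A_iff B_iff W_eq C_def[symmetric] by auto
    finally show "openin X2 {x \<in> topspace X2. \<Union>x \<in> V} = openin M V"
      unfolding U_def .
  qed
  have "homeomorphic_map X2 M Union"
    using quot inj by (simp add: homeomorphic_map_def)
  \<comment> \<open>Uniqueness: every point of \<open>X2\<close> has the form
    \<open>q2 (q1 y)\<close>, so compatibility with the projections fixes the map.\<close>
  then show ?thesis
    using h_p by (intro exI[of _ Union]) (auto simp: top2)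
qed

end
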